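(* Let $x_1<\cdots<x_n$ be real numbers and let $m_1,\dots,m_n$ be real numbers. If $m_k>0$ for all $k$, then the residues $b_1,\dots,b_{n-1}$ of the Weyl function $W(z)=\dfrac{B(z)}{A(z)}=\sum_{k=1}^{n-1}\dfrac{b_k}{z-\lambda_k}$ of the discrete cubic string with Neumann-like boundary conditions with data $\{x_k,m_k\}_{k=1}^n$ are all negative.
   Context: Put $l_k=x_{k+1}-x_k$ and $$L_k=\begin{pmatrix}1&l_k&l_k^2/2\\0&1&l_k\\0&0&1\end{pmatrix},\qquad G_k(z)=\begin{pmatrix}1&0&0\\0&1&0\\-2m_kz&0&1\end{pmatrix}.$$ The polynomials $A,B,C$ are defined by $$(C(z),B(z),A(z))^t=G_n(z)L_{n-1}G_{n-1}(z)\cdots L_2G_2(z)L_1G_1(z)\,(1,0,0)^t.$$ (Equivalently, if $\phi$ solves $-\phi'''=zm\phi$ with $m(x)=2\sum_{k=1}^n m_k\delta(x-x_k)$ and $\phi=1$ for $x<x_1$, then $C=\phi(x_n^+)$, $B=\phi_x(x_n^+)$, $A=\phi_{xx}(x_n^+)$.) When all $m_k>0$, the polynomial $A$ has degree $n$ and simple zeros $0<\lambda_1<\cdots<\lambda_{n-1}$ together with $0$, and $B(0)=0$, so the Weyl function $W=B/A$ has the stated partial fraction decomposition, which defines the numbers $b_k$. *)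

theory Defs
  imports "HOL-Complex_Analysis.Complex_Analysis" "HOL-Computational_Algebra.Polynomial"
begin

text \<open>
  Entries are polynomials in the spectral variable \<open>z\<close>: \<open>[:c:]\<close> is the constant \<open>c\<close> and
  \<open>[:0, c:]\<close> is \<open>c * z\<close>. The data \<open>x k\<close>, \<open>m k\<close> are used for \<open>1 \<le> k \<le> n\<close> only.
\<close>

definition gap :: "(nat \<Rightarrow> real) \<Rightarrow> nat \<Rightarrow> real" where
  "gap x k = x (k + 1) - x k"

definition L_mat :: "(nat \<Rightarrow> real) \<Rightarrow> nat \<Rightarrow> complex poly ^ 3 ^ 3" where
  "L_mat x k = vector
     [vector [1, [:of_real (gap x k):], [:of_real ((gap x k)\<^sup>2 / 2):]],
      vector [0, 1, [:of_real (gap x k):]],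
      vector [0, 0, 1]]"

definition G_mat :: "(nat \<Rightarrow> real) \<Rightarrow> nat \<Rightarrow> complex poly ^ 3 ^ 3" where
  "G_mat m k = vector
     [vector [1, 0, 0],
      vector [0, 1, 0],
      vector [[:0, of_real (- 2 * m k):], 0, 1]]"

text \<open>
  For \<open>n \<ge> 1\<close> this is \<open>G\<^sub>n L\<^sub>n\<^sub>-\<^sub>1 G\<^sub>n\<^sub>-\<^sub>1 \<dots> L\<^sub>1 G\<^sub>1 (1, 0, 0)\<^sup>t\<close>, the vector
  \<open>(\<phi>, \<phi>\<^sub>x, \<phi>\<^sub>x\<^sub>x)\<close> just to the right of \<open>x n\<close>.
\<close>

fun string_state :: "(nat \<Rightarrow> real) \<Rightarrow> (nat \<Rightarrow> real) \<Rightarrow> nat \<Rightarrow> complex poly ^ 3" where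
  "string_state x m 0 = vector [1, 0, 0]"
| "string_state x m (Suc 0) = G_mat m 1 *v vector [1, 0, 0]"
| "string_state x m (Suc (Suc k)) =
     G_mat m (k + 2) *v (L_mat x (k + 1) *v string_state x m (Suc k))"

definition C_poly :: "(nat \<Rightarrow> real) \<Rightarrow> (nat \<Rightarrow> real) \<Rightarrow> nat \<Rightarrow> complex poly" where
  "C_poly x m n = string_state x m n $ 1"

definition B_poly :: "(nat \<Rightarrow> real) \<Rightarrow> (nat \<Rightarrow> real) \<Rightarrow> nat \<Rightarrow> complex poly" where
  "B_poly x m n = string_state x m n $ 2"

definition A_poly :: "(nat \<Rightarrow> real) \<Rightarrow> (nat \<Rightarrow> real) \<Rightarrow> nat \<Rightarrow> complex poly" where
  "A_poly x m n = string_state x m n $ 3"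

definition weyl :: "(nat \<Rightarrow> real) \<Rightarrow> (nat \<Rightarrow> real) \<Rightarrow> nat \<Rightarrow> complex \<Rightarrow> complex" where
  "weyl x m n z = poly (B_poly x m n) z / poly (A_poly x m n) z"

text \<open>
  \<open>lam 1 < \<dots> < lam (n - 1)\<close> are the positive zeros of \<open>A\<close>. Together with \<open>0\<close> they are \<open>n\<close>
  distinct zeros of a polynomial of degree \<open>n\<close>, so all zeros are simple; \<open>lam\<close> is determined
  uniquely on \<open>{1..n - 1}\<close>.
\<close>

definition neumann_spectrum ::
  "(nat \<Rightarrow> real) \<Rightarrow> (nat \<Rightarrow> real) \<Rightarrow> nat \<Rightarrow> (nat \<Rightarrow> real) \<Rightarrow> bool" where
  "neumann_spectrum x m n lam \<longleftrightarrow>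
     degree (A_poly x m n) = n \<and>
     strict_mono_on {1..n - 1} lam \<and>
     (\<forall>k\<in>{1..n - 1}. 0 < lam k) \<and>
     {z. poly (A_poly x m n) z = 0} = insert 0 ((\<lambda>k. complex_of_real (lam k)) ` {1..n - 1})"

end

theory Submission
  imports Defs "HOL-Computational_Algebra.Fundamental_Theorem_Algebra"
begin

text \<open>
  Put \<open>w = - z\<close>, so that \<open>A = w a\<close>, \<open>B = w b\<close> and all matrix entries become
  nonnegative. Call \<open>f\<close>, \<open>g\<close> interlacing at \<open>w\<close> if \<open>0 \<le> arg (g / f) \<le> arg w\<close>;
  written as \<open>Im (g \<cdot> cnj f) \<ge> 0\<close> and \<open>Im (w f \<cdot> cnj g) \<ge> 0\<close> this is additive in \<open>f\<close> and in
  \<open>g\<close>, and it passes from \<open>(f, g)\<close> to \<open>(g, w f)\<close>. Therefore all three pairs from the ordered triple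
  \<open>(b, a, C)\<close> interlace on the whole upper half plane, for every number of masses. Keeping
  track of the strict gain in each step yields \<open>a \<noteq> 0\<close> and
  \<open>Im (a \<cdot> cnj b) \<ge> k Im w \<bar>b\<bar>\<^sup>2\<close> with \<open>k > 0\<close>, whose limit at a root \<open>r\<close> of \<open>a\<close> is
  \<open>a'(r) b(r) \<le> - k b(r)\<^sup>2\<close> (derivative in \<open>z\<close>). As \<open>a\<close> and \<open>b\<close> have no common root,
  the roots are simple and the residues \<open>b(r) / a'(r)\<close> are negative.
\<close>

section \<open>Interlacing at a point of the upper half plane and its behaviour under one step of
  the string\<close>

definition interlace :: "complex \<Rightarrow> complex \<Rightarrow> complex \<Rightarrow> bool" where
  "interlace w f g \<longleftrightarrow> 0 \<le> Im (g * cnj f) \<and> 0 \<le> Im (w * f * cnj g)"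

lemma interlace_add_left: "interlace w f h \<Longrightarrow> interlace w g h \<Longrightarrow> interlace w (f + g) h"
  and interlace_add_right: "interlace w f g \<Longrightarrow> interlace w f h \<Longrightarrow> interlace w f (g + h)"
  by (simp_all add: interlace_def algebra_simps)

lemma interlace_scale_left:
  assumes "interlace w f g" "0 \<le> t"
  shows "interlace w (of_real t * f) g"
proof -
  have "Im (g * cnj (of_real t * f)) = t * Im (g * cnj f)"
    "Im (w * (of_real t * f) * cnj g) = t * Im (w * f * cnj g)"
    by (simp_all add: algebra_simps)
  with assms show ?thesis by (simp only: interlace_def) simp
qed

lemma interlace_scale_right:
  assumes "interlace w f g" "0 \<le> t"
  shows "interlace w f (of_real t * g)"
proof -
  have "Im (of_real t * g * cnj f) = t * Im (g * cnj f)"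
    "Im (w * f * cnj (of_real t * g)) = t * Im (w * f * cnj g)"
    by (simp_all add: algebra_simps)
  with assms show ?thesis by (simp only: interlace_def) simp
qed

lemma interlace_refl: "0 \<le> Im w \<Longrightarrow> interlace w f f"
proof -
  have "Im (f * cnj f) = 0" "Im (w * (f * cnj f)) = Im w * ((Re f)\<^sup>2 + (Im f)\<^sup>2)"
    by (simp_all add: power2_eq_square algebra_simps)
  then show "interlace w f f" if "0 \<le> Im w"
    using that by (simp add: interlace_def mult.assoc del: complex_cnj_mult times_complex.sel)
qed

text \<open>The angle from \<open>g\<close> to \<open>w * f\<close> is \<open>arg w\<close> minus
  the angle from \<open>f\<close> to \<open>g\<close>. Accordingly the two defining inequalities
  change places, one of them rescaled by the squared modulus of \<open>w\<close>.\<close>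

lemma interlace_shift:
  assumes "interlace w f g"
  shows "interlace w g (w * f)"
proof -
  have "Im (w * g * cnj (w * f)) = ((Re w)\<^sup>2 + (Im w)\<^sup>2) * Im (g * cnj f)"
    by (simp add: power2_eq_square algebra_simps)
  with assms show ?thesis by (simp add: interlace_def del: complex_cnj_mult)
qed

text \<open>Source of all strict gains: the added term contributes exactly the left-hand side, and
  \<open>h\<close> contributes a nonnegative amount.\<close>

lemma Im_mult_cnj_shift_ge:
  assumes "interlace w f h"
  shows "t * Im w * (cmod f)\<^sup>2 \<le> Im ((h + of_real t * (w * f)) * cnj f)"
proof -
  have "Im ((h + of_real t * (w * f)) * cnj f) = Im (h * cnj f) + t * Im (w * (f * cnj f))"
    by (simp add: algebra_simps)
  also have "Im (w * (f * cnj f)) = Im w * (cmod f)\<^sup>2"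
    by (simp only: complex_norm_square [symmetric] Im_complex_of_real times_complex.sel) simp
  finally show ?thesis using assms by (simp add: interlace_def)
qed

text \<open>The primed triple is the effect of one gap \<open>l\<close> followed by one mass
  \<open>s / 2\<close>, in the variable \<open>w = - z\<close> and with the factor \<open>w\<close>
  removed from \<open>A\<close> and \<open>B\<close>. The first three claims carry an induction. The
  fourth keeps \<open>a'\<close> from vanishing; the fifth is the bound that is later pushed to the
  real axis.\<close>

lemma interlace_step:
  fixes a b c w :: complex and l s :: real
  defines "b' \<equiv> b + of_real l * a"
    and "c' \<equiv> c + w * (of_real l * b + of_real (l\<^sup>2 / 2) * a)"
  defines "a' \<equiv> a + of_real s * c'"
  assumes w: "0 < Im w" and l: "0 < l" and s: "0 < s"
    and ba: "interlace w b a" and bc: "interlace w b c" and ac: "interlace w a c"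
  shows "interlace w b' a'" "interlace w b' c'" "interlace w a' c'"
    and "l\<^sup>2 / 2 * Im w * (cmod a)\<^sup>2 \<le> Im (c' * cnj a)"
    and "s * (l / 2) * Im w * (cmod b')\<^sup>2 \<le> Im (a' * cnj b')"
proof -
  have refl: "interlace w f f" for f using w by (simp add: interlace_refl)
  have b'a: "interlace w b' a" unfolding b'_def
    using ba refl l by (intro interlace_add_left interlace_scale_left) auto
  have b'c: "interlace w b' c" unfolding b'_def
    using bc ac l by (intro interlace_add_left interlace_scale_left) auto
  have bb': "interlace w b b'" unfolding b'_def
    using ba refl l by (intro interlace_add_right interlace_scale_right) auto
  \<comment> \<open>Although \<open>b\<close> and \<open>w * a\<close> need not interlace, this regrouping of \<open>c'\<close> only involves \<open>w * b'\<close> and \<open>w * b\<close>.\<close>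
  have c'_b': "c' = (c + of_real (l / 2) * (w * b)) + of_real (l / 2) * (w * b')"
    by (simp add: c'_def b'_def algebra_simps power2_eq_square)
  have c'_a: "c' = (c + of_real l * (w * b)) + of_real (l\<^sup>2 / 2) * (w * a)"
    by (simp add: c'_def algebra_simps)
  have h1: "interlace w b' (c + of_real (l / 2) * (w * b))"
    using b'c bb' l by (intro interlace_add_right interlace_scale_right interlace_shift) auto
  show b'c': "interlace w b' c'" unfolding c'_b'
    using h1 refl l by (intro interlace_add_right [OF h1] interlace_scale_right interlace_shift) auto
  have h2: "interlace w a (c + of_real l * (w * b))"
    using ac ba l by (intro interlace_add_right interlace_scale_right interlace_shift) auto
  have ac': "interlace w a c'" unfolding c'_a
    using refl by (intro interlace_add_right [OF h2] interlace_scale_right interlace_shift) auto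
  show "interlace w b' a'" unfolding a'_def
    using b'a b'c' s by (intro interlace_add_right interlace_scale_right) auto
  show "interlace w a' c'" unfolding a'_def
    using ac' refl s by (intro interlace_add_left interlace_scale_left) auto
  show "l\<^sup>2 / 2 * Im w * (cmod a)\<^sup>2 \<le> Im (c' * cnj a)"
    using Im_mult_cnj_shift_ge [OF h2, of "l\<^sup>2 / 2"] by (simp only: c'_a)
  have "s * (l / 2 * Im w * (cmod b')\<^sup>2) \<le> s * Im (c' * cnj b')"
    using Im_mult_cnj_shift_ge [OF h1, of "l / 2", folded c'_b'] s by (intro mult_left_mono) auto
  also have "\<dots> \<le> Im (a * cnj b') + s * Im (c' * cnj b')"
    using b'a by (simp add: interlace_def)
  also have "\<dots> = Im (a' * cnj b')" by (simp add: a'_def algebra_simps)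
  finally show "s * (l / 2) * Im w * (cmod b')\<^sup>2 \<le> Im (a' * cnj b')"
    by (simp add: mult.assoc)
qed

section \<open>Polynomials with simple roots: partial fractions and the sign of the derivative at a
  root\<close>

lemma card_simple_roots:
  fixes p :: "complex poly"
  assumes "\<And>z. poly p z = 0 \<Longrightarrow> poly (pderiv p) z \<noteq> 0"
  shows "card {z. poly p z = 0} = degree p"
proof -
  have "rsquarefree p" using assms by (auto simp: rsquarefree_roots)
  then have p0: "p \<noteq> 0" by (auto simp: rsquarefree_def)
  have "degree p = degree (\<Prod>z | poly p z = 0. [:- z, 1:])"
    using complex_poly_decompose_rsquarefree [OF \<open>rsquarefree p\<close>] p0
    by (metis degree_smult_eq leading_coeff_0_iff)
  also have "\<dots> = card {z. poly p z = 0}"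
    by (simp add: degree_prod_sum_eq)
  finally show ?thesis by simp
qed

lemma poly_pderiv_linear_factor:
  fixes h :: "'a :: idom poly"
  shows "poly (pderiv ([:- r, 1:] * h)) r = poly h r"
  by (simp add: pderiv_mult pderiv_pCons del: mult_pCons_left)

text \<open>Lagrange interpolation: the cofactor \<open>h r\<close> of the root \<open>r\<close>
  vanishes at all other roots and equals \<open>p'(r)\<close> at \<open>r\<close>. Hence
  \<open>S\<close> agrees with \<open>q\<close> at \<open>degree p\<close> points, and both have
  smaller degree.\<close>

lemma partial_fractions_simple_roots:
  fixes p q :: "complex poly"
  assumes simple: "\<And>z. poly p z = 0 \<Longrightarrow> poly (pderiv p) z \<noteq> 0"
    and deg: "q = 0 \<or> degree q < degree p" and z: "poly p z \<noteq> 0"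
  shows "poly q z / poly p z =
    (\<Sum>r | poly p r = 0. poly q r / poly (pderiv p) r / (z - r))"
proof (cases "q = 0")
  case False
  let ?R = "{r. poly p r = 0}"
  have "p \<noteq> 0" using z by auto
  then have fin: "finite ?R" by (rule poly_roots_finite)
  have "\<exists>h. p = [:- r, 1:] * h" if "poly p r = 0" for r
    using that by (auto simp: poly_eq_0_iff_dvd dvd_def)
  then obtain h where h: "p = [:- r, 1:] * h r" if "poly p r = 0" for r by metis
  have h_root: "poly (h r) r = poly (pderiv p) r" if "poly p r = 0" for r
    by (metis h poly_pderiv_linear_factor that)
  have h_eval: "(s - r) * poly (h r) s = poly p s" if "poly p r = 0" for r s
  proof -
    have "poly p s = poly ([:- r, 1:] * h r) s"
      using h [OF that] by (rule arg_cong [where f = "\<lambda>p. poly p s"])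
    then show ?thesis by (simp add: algebra_simps)
  qed
  have h_deg: "degree (h r) < degree p" if "poly p r = 0" for r
  proof -
    have "h r \<noteq> 0" using h [OF that] \<open>p \<noteq> 0\<close> by auto
    then have "degree ([:- r, 1:] * h r) = Suc (degree (h r))" by (subst degree_mult_eq) auto
    moreover have "degree p = degree ([:- r, 1:] * h r)"
      using h [OF that] by (rule arg_cong [where f = degree])
    ultimately show ?thesis by simp
  qed
  define S where "S = (\<Sum>r\<in>?R. smult (poly q r / poly (pderiv p) r) (h r))"
  have "degree p > 0" using False deg by auto
  have "q = S"
  proof (rule poly_eqI_degree [where A = ?R])
    fix s assume s: "s \<in> ?R"
    have "poly S s = (\<Sum>r\<in>?R. poly q r / poly (pderiv p) r * poly (h r) s)"
      by (simp add: S_def poly_sum)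
    also have "\<dots> = (\<Sum>r\<in>?R. if r = s then poly q s else 0)"
    proof (intro sum.cong refl)
      fix r assume r: "r \<in> ?R"
      show "poly q r / poly (pderiv p) r * poly (h r) s = (if r = s then poly q s else 0)"
      proof (cases "r = s")
        case True
        then show ?thesis using r simple [of s] h_root [of s] by simp
      next
        case False
        then show ?thesis using r s h_eval [of r s] by simp
      qed
    qed
    also have "\<dots> = poly q s" using s fin by simp
    finally show "poly q s = poly S s" by simp
  next
    show "degree q < card ?R" using False deg card_simple_roots [OF simple] by simp
  next
    have "degree S \<le> degree p - 1" unfolding S_def
      using fin h_deg by (intro degree_sum_le) (auto intro!: order.trans [OF degree_smult_le] dest!: h_deg)
    then show "degree S < card ?R"
      using \<open>degree p > 0\<close> card_simple_roots [OF simple] by simp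
  qed
  then have "poly q z = poly S z" by (rule arg_cong)
  also have "\<dots> = (\<Sum>r\<in>?R. poly q r / poly (pderiv p) r * poly (h r) z)"
    by (simp add: S_def poly_sum)
  also have "\<dots> = (\<Sum>r\<in>?R. poly q r / poly (pderiv p) r / (z - r) * poly p z)"
  proof (intro sum.cong refl)
    fix r assume "r \<in> ?R"
    then have "(z - r) * poly (h r) z = poly p z" "z - r \<noteq> 0" using h_eval z by auto
    then show "poly q r / poly (pderiv p) r * poly (h r) z =
        poly q r / poly (pderiv p) r / (z - r) * poly p z"
      by (simp flip: \<open>(z - r) * poly (h r) z = poly p z\<close>)
  qed
  finally have "poly q z = (\<Sum>r\<in>?R. poly q r / poly (pderiv p) r / (z - r)) * poly p z"
    by (simp only: sum_distrib_right)
  with z show ?thesis by (metis nonzero_mult_div_cancel_right)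
qed simp

text \<open>Letting \<open>- w\<close> approach \<open>r\<close> vertically, the hypothesis becomes \<open>k \<bar>q(r)\<bar>\<^sup>2 \<le> - Re (p'(r) \<cdot> cnj (q(r)))\<close>.\<close>

lemma pderiv_mult_neg_at_root:
  fixes p q :: "complex poly" and r :: real
  assumes k: "0 < k"
    and ineq: "\<And>w. 0 < Im w \<Longrightarrow>
      k * Im w * (cmod (poly q (- w)))\<^sup>2 \<le> Im (poly p (- w) * cnj (poly q (- w)))"
    and root: "poly p (of_real r) = 0" and nz: "poly q (of_real r) \<noteq> 0"
  shows "Re (poly (pderiv p) (of_real r) * cnj (poly q (of_real r))) < 0"
proof -
  obtain h where h: "p = [:- of_real r, 1:] * h"
    using root by (auto simp: poly_eq_0_iff_dvd dvd_def)
  have hr: "poly (pderiv p) (of_real r) = poly h (of_real r)"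
    by (simp only: h poly_pderiv_linear_factor)
  define z where "z y = complex_of_real r - \<i> * of_real y" for y :: real
  have lim: "((\<lambda>y. f (z y)) \<longlongrightarrow> f (of_real r)) (at_right 0)"
    if "continuous_on UNIV f" for f :: "complex \<Rightarrow> real"
  proof -
    have "continuous_on UNIV z" unfolding z_def by (intro continuous_intros)
    then have "continuous_on UNIV (\<lambda>y. f (z y))"
      by (rule continuous_on_compose2 [OF that]) simp
    then have "isCont (\<lambda>y. f (z y)) 0" by (simp add: continuous_on_eq_continuous_at)
    then have "((\<lambda>y. f (z y)) \<longlongrightarrow> f (z 0)) (at_right 0)"
      using continuous_within filterlim_at_split isCont_def by blast
    then show ?thesis by (simp add: z_def)
  qed
  \<comment> \<open>A limit preserves only \<le>. The quadratic term on the left survives it, so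
    strictness returns through \<open>k\<close> and \<open>nz\<close>.\<close>
  have "k * (cmod (poly q (of_real r)))\<^sup>2 \<le> - Re (poly h (of_real r) * cnj (poly q (of_real r)))"
  proof (rule tendsto_le)
    show "((\<lambda>y. k * (cmod (poly q (z y)))\<^sup>2) \<longlongrightarrow> k * (cmod (poly q (of_real r)))\<^sup>2) (at_right 0)"
      "((\<lambda>y. - Re (poly h (z y) * cnj (poly q (z y)))) \<longlongrightarrow>
         - Re (poly h (of_real r) * cnj (poly q (of_real r)))) (at_right 0)"
      by (rule lim; intro continuous_intros)+
    show "\<forall>\<^sub>F y in at_right 0. k * (cmod (poly q (z y)))\<^sup>2 \<le> - Re (poly h (z y) * cnj (poly q (z y)))"
    proof (rule eventually_at_right_less [THEN eventually_mono])
      fix y :: real assume y: "0 < y"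
      \<comment> \<open>Both sides of \<open>ineq\<close> carry a factor \<open>y\<close>: from
        \<open>Im w\<close> on the left, from the linear factor of \<open>p\<close> on the right.
        After cancelling it, \<open>p\<close> is replaced by \<open>h\<close>, whose value at
        \<open>r\<close> is \<open>p'(r)\<close>.\<close>
      have "poly p (z y) = - \<i> * of_real y * poly h (z y)"
        by (simp add: h z_def algebra_simps)
      then have "Im (poly p (z y) * cnj (poly q (z y))) =
          y * (- Re (poly h (z y) * cnj (poly q (z y))))"
        by (simp add: algebra_simps)
      moreover have "Im (- z y) = y" by (simp add: z_def)
      ultimately have "y * (k * (cmod (poly q (z y)))\<^sup>2) \<le> y * (- Re (poly h (z y) * cnj (poly q (z y))))"
        using ineq [of "- z y"] y by (simp only: minus_minus) (simp add: mult_ac)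
      then show "k * (cmod (poly q (z y)))\<^sup>2 \<le> - Re (poly h (z y) * cnj (poly q (z y)))"
        using y by (simp only: mult_le_cancel_left_pos)
    qed
  qed simp
  moreover have "0 < k * (cmod (poly q (of_real r)))\<^sup>2" using k nz by simp
  ultimately show ?thesis unfolding hr by linarith
qed

section \<open>The state vector with the factor \<open>- z\<close> divided out of \<open>A\<close>
  and \<open>B\<close>\<close>

text \<open>The index \<open>j\<close> belongs to the first \<open>j + 1\<close> masses.\<close>

fun reduced_C :: "(nat \<Rightarrow> real) \<Rightarrow> (nat \<Rightarrow> real) \<Rightarrow> nat \<Rightarrow> complex poly"
  and reduced_B :: "(nat \<Rightarrow> real) \<Rightarrow> (nat \<Rightarrow> real) \<Rightarrow> nat \<Rightarrow> complex poly"
  and reduced_A :: "(nat \<Rightarrow> real) \<Rightarrow> (nat \<Rightarrow> real) \<Rightarrow> nat \<Rightarrow> complex poly"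
where
  "reduced_C x m 0 = 1"
| "reduced_C x m (Suc j) = reduced_C x m j + [:0, -1:] *
     (smult (of_real (gap x (Suc j))) (reduced_B x m j) +
      smult (of_real ((gap x (Suc j))\<^sup>2 / 2)) (reduced_A x m j))"
| "reduced_B x m 0 = 0"
| "reduced_B x m (Suc j) = reduced_B x m j + smult (of_real (gap x (Suc j))) (reduced_A x m j)"
| "reduced_A x m 0 = [:of_real (2 * m 1):]"
| "reduced_A x m (Suc j) = reduced_A x m j +
     smult (of_real (2 * m (Suc (Suc j)))) (reduced_C x m (Suc j))"


lemma G_mat_mult:
  "(G_mat m k *v v) $ 1 = v $ 1"
  "(G_mat m k *v v) $ 2 = v $ 2"
  "(G_mat m k *v v) $ 3 = [:0, of_real (- 2 * m k):] * v $ 1 + v $ 3"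
  by (simp_all add: matrix_vector_mult_def sum_3 G_mat_def)

lemma L_mat_mult:
  "(L_mat x k *v v) $ 1 = v $ 1 + [:of_real (gap x k):] * v $ 2 + [:of_real ((gap x k)\<^sup>2 / 2):] * v $ 3"
  "(L_mat x k *v v) $ 2 = v $ 2 + [:of_real (gap x k):] * v $ 3"
  "(L_mat x k *v v) $ 3 = v $ 3"
  by (simp_all add: matrix_vector_mult_def sum_3 L_mat_def)

lemma string_state_reduced:
  "string_state x m (Suc j) $ 1 = reduced_C x m j \<and>
   string_state x m (Suc j) $ 2 = [:0, -1:] * reduced_B x m j \<and>
   string_state x m (Suc j) $ 3 = [:0, -1:] * reduced_A x m j"
proof (induction j)
  case 0
  show ?case by (simp add: G_mat_mult)
next
  case (Suc j)
  then have IH: "string_state x m (Suc j) $ 1 = reduced_C x m j"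
    "string_state x m (Suc j) $ 2 = [:0, -1:] * reduced_B x m j"
    "string_state x m (Suc j) $ 3 = [:0, -1:] * reduced_A x m j" by blast+
  have idx: "j + 2 = Suc (Suc j)" "j + 1 = Suc j" by simp_all
  show ?case
    unfolding string_state.simps G_mat_mult L_mat_mult IH reduced_C.simps reduced_B.simps
      reduced_A.simps idx
    \<comment> \<open>Over the complex numbers polynomial identities may be checked as identities of
      functions, which leaves ring equations at a point.\<close>
    by (intro conjI; subst poly_eq_poly_eq_iff [symmetric]; rule ext;
        simp only: poly_add poly_mult poly_smult poly_pCons poly_0 of_real_mult of_real_minus
          of_real_numeral; algebra)
qed

section \<open>Interlacing along a string with positive gaps and masses\<close>

locale positive_string =
  fixes x m :: "nat \<Rightarrow> real" and n :: nat
  assumes gap_pos: "1 \<le> k \<Longrightarrow> k < n \<Longrightarrow> 0 < gap x k"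
    and mass_pos: "1 \<le> k \<Longrightarrow> k \<le> n \<Longrightarrow> 0 < m k"
begin

abbreviation "c \<equiv> reduced_C x m"
abbreviation "b \<equiv> reduced_B x m"
abbreviation "a \<equiv> reduced_A x m"

text \<open>Evaluation at \<open>- w\<close> turns the factor \<open>[:0, -1:]\<close> into
  \<open>w\<close>, so no minus sign remains and the right-hand sides are literally the primed terms
  of \<open>interlace_step\<close>.\<close>

lemma poly_Suc:
  "poly (c (Suc j)) (- w) = poly (c j) (- w) + w *
     (of_real (gap x (Suc j)) * poly (b j) (- w) +
      of_real ((gap x (Suc j))\<^sup>2 / 2) * poly (a j) (- w))"
  "poly (b (Suc j)) (- w) = poly (b j) (- w) + of_real (gap x (Suc j)) * poly (a j) (- w)"
  "poly (a (Suc j)) (- w) =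
     poly (a j) (- w) + of_real (2 * m (Suc (Suc j))) * poly (c (Suc j)) (- w)"
proof -
  have w: "poly [:0, -1:] (- w) = w" by simp
  show "poly (c (Suc j)) (- w) = poly (c j) (- w) + w *
     (of_real (gap x (Suc j)) * poly (b j) (- w) +
      of_real ((gap x (Suc j))\<^sup>2 / 2) * poly (a j) (- w))"
    by (simp only: reduced_C.simps poly_add poly_mult poly_smult w)
qed (simp_all only: reduced_B.simps reduced_A.simps poly_add poly_smult)

text \<open>Nonvanishing of \<open>a\<close> has to be part of the induction: the gain from the
  fourth claim of \<open>interlace_step\<close> is proportional to the squared modulus of the
  previous \<open>a\<close>.\<close>

lemma interlacing:
  assumes "j < n" "0 < Im w"
  shows "interlace w (poly (b j) (- w)) (poly (a j) (- w)) \<and>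
    interlace w (poly (b j) (- w)) (poly (c j) (- w)) \<and>
    interlace w (poly (a j) (- w)) (poly (c j) (- w)) \<and>
    poly (a j) (- w) \<noteq> 0"
  using \<open>j < n\<close>
proof (induction j)
  case 0
  with mass_pos [of 1] assms(2) show ?case
    by (simp add: interlace_def)
next
  case (Suc j)
  let ?l = "gap x (Suc j)" and ?s = "2 * m (Suc (Suc j))"
  have l: "0 < ?l" and s: "0 < ?s" using Suc.prems gap_pos mass_pos by auto
  from Suc have IH: "interlace w (poly (b j) (- w)) (poly (a j) (- w))"
    "interlace w (poly (b j) (- w)) (poly (c j) (- w))"
    "interlace w (poly (a j) (- w)) (poly (c j) (- w))"
    and nz: "poly (a j) (- w) \<noteq> 0" by auto
  note step = interlace_step [OF assms(2) l s IH, folded poly_Suc]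
  have "0 < ?l\<^sup>2 / 2 * Im w * (cmod (poly (a j) (- w)))\<^sup>2"
    using l assms(2) nz by simp
  with step(4) have "0 < Im (poly (c (Suc j)) (- w) * cnj (poly (a j) (- w)))" by linarith
  \<comment> \<open>The old \<open>a\<close> times its own conjugate is real, so only the new
    \<open>c\<close> contributes.\<close>
  moreover have "Im (poly (a (Suc j)) (- w) * cnj (poly (a j) (- w))) =
      ?s * Im (poly (c (Suc j)) (- w) * cnj (poly (a j) (- w)))"
    unfolding poly_Suc(3) by (simp add: algebra_simps del: reduced_C.simps)
  ultimately have "0 < Im (poly (a (Suc j)) (- w) * cnj (poly (a j) (- w)))"
    using s by (simp only: mult_pos_pos)
  then have "poly (a (Suc j)) (- w) \<noteq> 0"
    by (metis less_irrefl mult_zero_left zero_complex.sel(2))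
  with step show ?case by blast
qed

text \<open>The constant comes from the last gap and the last mass alone. Its independence of
  \<open>w\<close> allows the limit towards a real root.\<close>

lemma Im_mult_cnj_ge:
  assumes "0 < j" "j < n"
  obtains k where "0 < k"
    "\<And>w. 0 < Im w \<Longrightarrow>
       k * Im w * (cmod (poly (b j) (- w)))\<^sup>2 \<le> Im (poly (a j) (- w) * cnj (poly (b j) (- w)))"
proof -
  obtain i where j: "j = Suc i" using \<open>0 < j\<close> gr0_implies_Suc by blast
  let ?l = "gap x (Suc i)" and ?s = "2 * m (Suc (Suc i))"
  have l: "0 < ?l" and s: "0 < ?s" using \<open>j < n\<close> gap_pos mass_pos unfolding j by auto
  show thesis
  proof
    show "0 < ?s * (?l / 2)" using l s by simp
    fix w :: complex assume w: "0 < Im w"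
    have "i < n" using \<open>j < n\<close> j by simp
    with interlacing [OF _ w, of i] have IH: "interlace w (poly (b i) (- w)) (poly (a i) (- w))"
      "interlace w (poly (b i) (- w)) (poly (c i) (- w))"
      "interlace w (poly (a i) (- w)) (poly (c i) (- w))" by auto
    show "?s * (?l / 2) * Im w * (cmod (poly (b j) (- w)))\<^sup>2
        \<le> Im (poly (a j) (- w) * cnj (poly (b j) (- w)))"
      unfolding j by (rule interlace_step(5) [OF w l s IH, folded poly_Suc])
  qed
qed

section \<open>Location, simplicity and number of the roots of \<open>a\<close>\<close>

lemma coeff_real:
  "coeff (c j) i \<in> \<real> \<and> coeff (b j) i \<in> \<real> \<and> coeff (a j) i \<in> \<real>"
  by (induction j arbitrary: i) (auto simp: coeff_pCons split: nat.split)

lemma cnj_poly_A: "poly (a j) (cnj z) = cnj (poly (a j) z)"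
  using coeff_real by (simp add: poly_cnj_real)

lemma poly_real:
  "poly (b j) (of_real t) \<in> \<real>" "poly (pderiv (a j)) (of_real t) \<in> \<real>"
  by (auto simp: poly_altdef coeff_real coeff_pderiv
      intro!: sum_in_Reals Reals_mult Reals_power)

text \<open>At \<open>z = - t\<close> each step only adds nonnegative terms. This excludes roots of
  \<open>a\<close> on the nonpositive axis and also supplies the reflected value needed in
  \<open>no_common_root\<close>.\<close>

lemma positive_on_nonpos:
  assumes "j < n" "0 \<le> t"
  shows "\<exists>\<alpha> \<beta> \<gamma> :: real. poly (a j) (- of_real t) = of_real \<alpha> \<and>
    poly (b j) (- of_real t) = of_real \<beta> \<and> poly (c j) (- of_real t) = of_real \<gamma> \<and>
    0 < \<alpha> \<and> 0 \<le> \<beta> \<and> 0 < \<gamma>"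
  using assms(1)
proof (induction j)
  case 0
  then show ?case using mass_pos [of 1] by (intro exI [of _ "2 * m 1"] exI [of _ 0] exI [of _ 1]) simp
next
  case (Suc j)
  then obtain \<alpha> \<beta> \<gamma> :: real where IH: "poly (a j) (- of_real t) = of_real \<alpha>"
    "poly (b j) (- of_real t) = of_real \<beta>" "poly (c j) (- of_real t) = of_real \<gamma>"
    "0 < \<alpha>" "0 \<le> \<beta>" "0 < \<gamma>" by auto
  have l: "0 < gap x (Suc j)" "0 < m (Suc (Suc j))" using Suc.prems gap_pos mass_pos by auto
  define \<gamma>' where "\<gamma>' = \<gamma> + t * (gap x (Suc j) * \<beta> + (gap x (Suc j))\<^sup>2 / 2 * \<alpha>)"
  have "0 < \<gamma>'" unfolding \<gamma>'_def using IH l assms(2) by (intro add_pos_nonneg) auto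
  moreover have "poly (c (Suc j)) (- of_real t) = of_real \<gamma>'"
    unfolding poly_Suc IH \<gamma>'_def by simp
  moreover have "poly (b (Suc j)) (- of_real t) = of_real (\<beta> + gap x (Suc j) * \<alpha>)"
    unfolding poly_Suc IH by simp
  moreover have "poly (a (Suc j)) (- of_real t) = of_real (\<alpha> + 2 * m (Suc (Suc j)) * \<gamma>')"
    unfolding poly_Suc(3) IH(1) calculation(2) by simp
  moreover have "0 < \<alpha> + 2 * m (Suc (Suc j)) * \<gamma>'" "0 \<le> \<beta> + gap x (Suc j) * \<alpha>"
    using IH l \<open>0 < \<gamma>'\<close> by (auto intro: add_pos_pos)
  ultimately show ?case by blast
qed

text \<open>The matrices preserve the symmetric form \<open>u\<^sub>1 v\<^sub>3 - u\<^sub>2 v\<^sub>2 + u\<^sub>3 v\<^sub>1\<close>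
  between the spectral parameters \<open>z\<close> and \<open>- z\<close>.\<close>

lemma isotropy:
  "poly (c j) z * poly (a j) (- z) + z * poly (b j) z * poly (b j) (- z)
     - poly (a j) z * poly (c j) (- z) = 0"
proof (induction j)
  case (Suc j)
  then show ?case by (simp add: power2_eq_square) algebra
qed simp

text \<open>Each step is invertible: if the new triple vanishes, then so do the old
  \<open>a\<close>, then \<open>b\<close>, then \<open>c\<close>.\<close>

lemma nonzero_state:
  "\<not> (poly (c j) z = 0 \<and> poly (b j) z = 0 \<and> poly (a j) z = 0)"
proof (induction j)
  case (Suc j)
  then show ?case
    using poly_Suc [of j "- z"] by auto
qed simp

text \<open>At a common root \<open>t\<close>, \<open>isotropy\<close> collapses to
  \<open>c(t) a(-t) = 0\<close>. Positivity at \<open>- t\<close> forces \<open>c(t) = 0\<close>,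
  and the whole state would vanish.\<close>

lemma no_common_root:
  assumes "j < n" "0 \<le> t" "poly (a j) (of_real t) = 0"
  shows "poly (b j) (of_real t) \<noteq> 0"
proof
  assume b: "poly (b j) (of_real t) = 0"
  have "poly (a j) (- of_real t) \<noteq> 0"
    using positive_on_nonpos [OF assms(1,2)] by force
  with isotropy [of j "of_real t"] b assms(3) have "poly (c j) (of_real t) = 0" by simp
  with nonzero_state [of j] b assms(3) show False by blast
qed

text \<open>Interlacing excludes roots in the lower half plane, conjugation those in the upper one,
  and \<open>positive_on_nonpos\<close> those on the rest of the real line.\<close>

lemma roots_positive:
  assumes "j < n" "poly (a j) z = 0"
  obtains t where "0 < t" "z = of_real t"
proof -
  have "Im z = 0"
  proof (rule ccontr)
    assume "Im z \<noteq> 0"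
    then consider "Im z < 0" | "Im z > 0" by linarith
    then show False
    proof cases
      case 1
      then show False using interlacing [OF assms(1), of "- z"] assms(2) by simp
    next
      case 2
      then show False
        using interlacing [OF assms(1), of "- cnj z"] assms(2) cnj_poly_A [of j z] by simp
    qed
  qed
  then have z: "z = of_real (Re z)" by (simp add: complex_eq_iff)
  moreover have "0 < Re z"
  proof (rule ccontr)
    assume "\<not> 0 < Re z"
    then have "poly (a j) (- of_real (- Re z)) \<noteq> 0"
      using positive_on_nonpos [OF assms(1), of "- Re z"] by force
    with z assms(2) show False by simp
  qed
  ultimately show thesis using that by blast
qed

lemma pderiv_mult_neg:
  assumes "0 < j" "j < n" "poly (a j) (of_real t) = 0"
  shows "Re (poly (pderiv (a j)) (of_real t) * cnj (poly (b j) (of_real t))) < 0"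
proof -
  obtain t' :: real where "0 < t'" "complex_of_real t = of_real t'"
    using roots_positive [OF assms(2,3)] by metis
  then have "poly (b j) (of_real t) \<noteq> 0"
    using no_common_root assms by (metis less_eq_real_def)
  moreover obtain k where "0 < k" "\<And>w. 0 < Im w \<Longrightarrow>
       k * Im w * (cmod (poly (b j) (- w)))\<^sup>2 \<le> Im (poly (a j) (- w) * cnj (poly (b j) (- w)))"
    using Im_mult_cnj_ge [OF assms(1,2)] by blast
  ultimately show ?thesis using pderiv_mult_neg_at_root assms(3) by blast
qed

text \<open>The condition \<open>coeff (b j) j = 0\<close> expresses degree below \<open>j\<close>
  in a form that also covers the zero polynomial \<open>b 0\<close>.\<close>

lemma degree_reduced:
  assumes "j < n"
  shows "degree (a j) \<le> j \<and> degree (b j) \<le> j \<and> degree (c j) \<le> j \<and> coeff (b j) j = 0 \<and>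
    (\<exists>\<alpha> \<gamma> :: real. 0 < \<alpha> \<and> 0 < \<gamma> \<and> coeff (a j) j = (-1) ^ j * of_real \<alpha> \<and>
      coeff (c j) j = (-1) ^ j * of_real \<gamma>)"
  using assms
proof (induction j)
  case 0
  then show ?case using mass_pos [of 1] by (simp, intro exI [of _ "2 * m 1"] exI [of _ 1]) simp
next
  case (Suc j)
  then obtain \<alpha> \<gamma> :: real where IH: "degree (a j) \<le> j" "degree (b j) \<le> j" "degree (c j) \<le> j"
    "coeff (b j) j = 0" "0 < \<alpha>" "0 < \<gamma>" "coeff (a j) j = (-1) ^ j * of_real \<alpha>"
    "coeff (c j) j = (-1) ^ j * of_real \<gamma>" by auto
  have l: "0 < gap x (Suc j)" "0 < m (Suc (Suc j))" using Suc.prems gap_pos mass_pos by auto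
  have vanish: "coeff (a j) (Suc j) = 0" "coeff (b j) (Suc j) = 0" "coeff (c j) (Suc j) = 0"
    using IH by (auto intro!: coeff_eq_0)
  have db: "degree (b (Suc j)) \<le> Suc j"
    using IH by (auto intro!: degree_add_le order.trans [OF degree_smult_le])
  have dc: "degree (c (Suc j)) \<le> Suc j"
    unfolding reduced_C.simps
    using IH by (auto intro!: degree_add_le degree_diff_le order.trans [OF degree_smult_le]
        order.trans [OF degree_mult_le] order.trans [OF degree_pCons_le])
  have da: "degree (a (Suc j)) \<le> Suc j"
    unfolding reduced_A.simps using IH dc
    by (auto intro!: degree_add_le order.trans [OF degree_smult_le] simp del: reduced_C.simps)
  \<comment> \<open>Since \<open>coeff (b j) j = 0\<close>, the top coefficient of
    \<open>c (Suc j)\<close> comes from \<open>a j\<close> alone, with one more sign.\<close>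
  define \<gamma>' where "\<gamma>' = (gap x (Suc j))\<^sup>2 / 2 * \<alpha>"
  have "coeff (c (Suc j)) (Suc j) = (-1) ^ Suc j * of_real \<gamma>'"
    using IH vanish by (simp add: \<gamma>'_def)
  moreover from this have "coeff (a (Suc j)) (Suc j) =
      (-1) ^ Suc j * of_real (2 * m (Suc (Suc j)) * \<gamma>')"
    unfolding reduced_A.simps using vanish by (simp del: reduced_C.simps)
  moreover have "0 < \<gamma>'" "0 < 2 * m (Suc (Suc j)) * \<gamma>'" using l IH by (auto simp: \<gamma>'_def)
  moreover have "coeff (b (Suc j)) (Suc j) = 0" using vanish by simp
  ultimately show ?case using da db dc by blast
qed

text \<open>For \<open>j = 0\<close> there is no root, \<open>a\<close> being a nonzero constant;
  otherwise the strict sign in \<open>pderiv_mult_neg\<close> rules out a vanishing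
  derivative.\<close>

lemma A_simple_roots:
  assumes "j < n" "poly (a j) z = 0"
  shows "poly (pderiv (a j)) z \<noteq> 0"
proof (cases "j = 0")
  case True
  with assms mass_pos [of 1] show ?thesis by simp
next
  case False
  with assms pderiv_mult_neg roots_positive show ?thesis
    by (metis less_irrefl mult_zero_left neq0_conv zero_complex.sel(1))
qed

lemma degree_A: "j < n \<Longrightarrow> degree (a j) = j"
  using degree_reduced [of j] le_degree [of "a j" j] by fastforce

lemma B_zero_or_degree_less:
  assumes "j < n"
  shows "b j = 0 \<or> degree (b j) < degree (a j)"
  using degree_reduced [OF assms] degree_A [OF assms]
  by (metis leading_coeff_0_iff order_le_less)

lemma enumerate_roots:
  assumes "j < n"
  obtains lam :: "nat \<Rightarrow> real"
  where "strict_mono_on {1..j} lam"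
    "bij_betw (\<lambda>k. complex_of_real (lam k)) {1..j} {z. poly (a j) z = 0}"
proof -
  let ?R = "{z. poly (a j) z = 0}"
  have "card ?R = j"
    using card_simple_roots A_simple_roots [OF assms] degree_A [OF assms] by metis
  have "a j \<noteq> 0" using A_simple_roots [OF assms] by force
  then have fin: "finite ?R" by (rule poly_roots_finite)
  have re: "complex_of_real (Re z) = z" if "z \<in> ?R" for z
  proof -
    from that have "poly (a j) z = 0" by simp
    then obtain t where "z = complex_of_real t" by (rule roots_positive [OF assms])
    then show ?thesis by simp
  qed
  define xs where "xs = sorted_list_of_set (Re ` ?R)"
  have "card (Re ` ?R) = j"
    using \<open>card ?R = j\<close> re by (subst card_image) (auto intro: inj_on_inverseI)
  then have len: "length xs = j" and set: "set xs = Re ` ?R" and "sorted_wrt (<) xs"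
    using fin by (auto simp: xs_def)
  define lam where "lam k = xs ! (k - 1)" for k
  have mono: "strict_mono_on {1..j} lam"
  proof (rule strict_mono_onI)
    fix r s assume "r \<in> {1..j}" "s \<in> {1..j}" "r < s"
    then show "lam r < lam s" unfolding lam_def
      by (intro sorted_wrt_nth_less [OF \<open>sorted_wrt (<) xs\<close>]) (auto simp: len)
  qed
  have "lam ` {1..j} = set xs"
  proof -
    have "lam ` {1..j} = lam ` Suc ` {..<j}" by (simp only: image_Suc_lessThan)
    also have "\<dots> = (!) xs ` {..<j}" by (simp add: lam_def image_image)
    also have "\<dots> = set xs" using len by (auto simp: set_conv_nth)
    finally show ?thesis .
  qed
  then have "(\<lambda>k. complex_of_real (lam k)) ` {1..j} = complex_of_real ` Re ` ?R"
    by (simp add: set flip: image_image [of complex_of_real lam])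
  also have "\<dots> = ?R" using re by force
  finally have image: "(\<lambda>k. complex_of_real (lam k)) ` {1..j} = ?R" .
  have "inj_on (\<lambda>k. complex_of_real (lam k)) {1..j}"
  proof (rule inj_onI)
    fix r s assume rs: "r \<in> {1..j}" "s \<in> {1..j}"
    assume "complex_of_real (lam r) = complex_of_real (lam s)"
    then have "lam r = lam s" by simp
    from inj_onD [OF strict_mono_on_imp_inj_on [OF mono] this rs] show "r = s" .
  qed
  then have "bij_betw (\<lambda>k. complex_of_real (lam k)) {1..j} ?R"
    using image by (rule bij_betw_imageI)
  with mono show thesis by (rule that)
qed

end

section \<open>Spectrum, partial fractions and residues of the Weyl function\<close>

theorem theorem3p5:
  fixes x m :: "nat \<Rightarrow> real" and n :: nat
  assumes "n \<ge> 1"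
    and "strict_mono_on {1..n} x"
    and "\<forall>k\<in>{1..n}. m k > 0"
  shows "\<exists>lam b :: nat \<Rightarrow> real.
           neumann_spectrum x m n lam \<and>
           (\<forall>z. poly (A_poly x m n) z \<noteq> 0 \<longrightarrow>
              weyl x m n z = (\<Sum>k = 1..n - 1. complex_of_real (b k) / (z - complex_of_real (lam k)))) \<and>
           (\<forall>k\<in>{1..n - 1}. residue (weyl x m n) (complex_of_real (lam k)) = complex_of_real (b k)) \<and>
           (\<forall>k\<in>{1..n - 1}. b k < 0)"
proof -
  interpret S: positive_string x m n
    using assms by unfold_locales (auto simp: gap_def strict_mono_on_def)
  obtain j where n: "n = Suc j" using assms(1) by (cases n) auto
  then have j: "j < n" by simp
  let ?a = "reduced_A x m j" and ?b = "reduced_B x m j"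
  have A: "A_poly x m n = [:0, -1:] * ?a" and B: "B_poly x m n = [:0, -1:] * ?b"
    using string_state_reduced [of x m j] by (simp_all only: A_poly_def B_poly_def n)
  obtain lam where mono: "strict_mono_on {1..j} lam"
    and bij: "bij_betw (\<lambda>k. complex_of_real (lam k)) {1..j} {z. poly ?a z = 0}"
    using S.enumerate_roots [OF j] .
  have root: "poly ?a (of_real (lam k)) = 0" if "k \<in> {1..j}" for k
    using bij_betw_apply [OF bij that] by simp
  have pos: "0 < lam k" if "k \<in> {1..j}" for k
    by (rule S.roots_positive [OF j root [OF that]]) simp
  have "?a \<noteq> 0" using S.A_simple_roots [OF j] by force
  then have "degree (A_poly x m n) = n"
    unfolding A using S.degree_A [OF j] by (subst degree_mult_eq) (auto simp: n)
  moreover have "{z. poly (A_poly x m n) z = 0} = insert 0 {z. poly ?a z = 0}"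
    by (auto simp: A)
  moreover have "n - 1 = j" by (simp add: n)
  ultimately have spectrum: "neumann_spectrum x m n lam"
    using mono pos bij_betw_imp_surj_on [OF bij] by (simp add: neumann_spectrum_def)
  \<comment> \<open>The residue of \<open>?b / ?a\<close> at a simple root; it is real because both
    polynomials have real coefficients.\<close>
  define \<beta> where "\<beta> k = Re (poly ?b (of_real (lam k)) / poly (pderiv ?a) (of_real (lam k)))" for k
  have \<beta>: "complex_of_real (\<beta> k) = poly ?b (of_real (lam k)) / poly (pderiv ?a) (of_real (lam k))" for k
    unfolding \<beta>_def by (intro of_real_Re Reals_divide S.poly_real)
  have "weyl x m n z = (\<Sum>k = 1..n - 1. complex_of_real (\<beta> k) / (z - complex_of_real (lam k)))"
    if z: "poly (A_poly x m n) z \<noteq> 0" for z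
  proof -
    have "weyl x m n z = poly ?b z / poly ?a z"
      using z by (simp add: weyl_def A B)
    also have "\<dots> = (\<Sum>r | poly ?a r = 0. poly ?b r / poly (pderiv ?a) r / (z - r))"
      using z S.A_simple_roots [OF j] S.B_zero_or_degree_less [OF j]
      by (intro partial_fractions_simple_roots) (auto simp: A)
    also have "\<dots> = (\<Sum>k = 1..j. complex_of_real (\<beta> k) / (z - complex_of_real (lam k)))"
      by (simp only: \<beta> flip: sum.reindex_bij_betw [OF bij])
    finally show ?thesis by (simp add: n)
  qed
  moreover have "residue (weyl x m n) (complex_of_real (lam k)) = complex_of_real (\<beta> k)"
    if k: "k \<in> {1..n - 1}" for k
  proof -
    let ?l = "complex_of_real (lam k)"
    have kj: "k \<in> {1..j}" using k by (simp add: n)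
    have l: "?l \<noteq> 0" using pos [OF kj] by simp
    \<comment> \<open>At a root of \<open>?a\<close> only the derivative of \<open>?a\<close>
      survives in the product rule; the remaining factor \<open>- ?l\<close> cancels against the one
      in \<open>B\<close>.\<close>
    have dA: "poly (pderiv (A_poly x m n)) ?l = - ?l * poly (pderiv ?a) ?l"
      using root [OF kj] by (simp add: A pderiv_mult pderiv_pCons pderiv_minus)
    have nz: "poly (pderiv ?a) ?l \<noteq> 0" "poly ?b ?l \<noteq> 0"
      using S.A_simple_roots [OF j root [OF kj]] S.no_common_root [OF j _ root [OF kj]] pos [OF kj]
      by auto
    have "residue (\<lambda>z. poly (B_poly x m n) z / poly (A_poly x m n) z) ?l =
        poly (B_poly x m n) ?l / poly (pderiv (A_poly x m n)) ?l"
    proof (rule residue_simple_pole_deriv [where s = UNIV])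
      show "(poly (A_poly x m n) has_field_derivative poly (pderiv (A_poly x m n)) ?l) (at ?l)"
        by (rule poly_DERIV)
      show "poly (A_poly x m n) ?l = 0" by (simp add: A root [OF kj])
      show "poly (B_poly x m n) ?l \<noteq> 0" using nz l by (simp add: B)
      show "poly (pderiv (A_poly x m n)) ?l \<noteq> 0" using nz l by (simp add: dA)
    qed (auto intro!: holomorphic_intros)
    also have "\<dots> = complex_of_real (\<beta> k)"
      using l by (simp add: dA B \<beta>)
    finally show ?thesis by (simp add: weyl_def [abs_def])
  qed
  moreover have "\<beta> k < 0" if k: "k \<in> {1..n - 1}" for k
  proof -
    have kj: "k \<in> {1..j}" using k by (simp add: n)
    obtain u v where uv: "poly (pderiv ?a) (of_real (lam k)) = of_real u"
      "poly ?b (of_real (lam k)) = of_real v"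
      using S.poly_real [of j "lam k"] by (auto elim!: Reals_cases)
    \<comment> \<open>A nonempty index range gives \<open>0 < j\<close>, as
      \<open>pderiv_mult_neg\<close> requires.\<close>
    have "u * v < 0"
      using S.pderiv_mult_neg [OF _ j root [OF kj]] kj by (simp add: uv)
    moreover have "\<beta> k = v / u" by (simp add: \<beta>_def uv flip: of_real_divide)
    ultimately show ?thesis by (auto simp: divide_less_0_iff mult_less_0_iff)
  qed
  ultimately show ?thesis using spectrum by blast
qed

end
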